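(* (Uniform category.) Let $X$ be a nonempty separable metric space. The following conditions are equivalent: (1) $\dim_u X\le 0$; (2) there exists a continuous increasing function $\mu\colon\mathbb{R}_+\to\mathbb{R}_+$ with $\mu(0)=0$ and $\lim_{t\to\infty}\mu(t)=\infty$ such that every nonempty closed subspace of $X$ is a $\mu$-uniform retract of $X$. (Proper Uniform category.) Let $X$ be an unbounded separable metric space. The following conditions are equivalent: (1) $\dim_u X\le 0$; (2) there exists a continuous increasing function $\mu\colon\mathbb{R}_+\to\mathbb{R}_+$ with $\mu(0)=0$ and $\lim_{t\to\infty}\mu(t)=\infty$ such that every unbounded closed subspace of $X$ is the image of a metrically proper $\mu$-uniform retraction of $X$.
   Context: Write $\mathbb{R}_+=[0,\infty)$. For $S>0$, an $S$-chain in a metric space $X$ is a finite sequence $x_1,\dots,x_k$ with $d(x_i,x_{i+1})\le S$ for all $i<k$. A subset is $S$-connected if any two of its points can be joined by an $S$-chain inside the subset; $S$-components of $X$ are maximal $S$-connected subsets. A subset is $D$-bounded if any two of its points are at distance $\le D$. $\dim_u(X)\le 0$ means: there is a continuous (strictly) increasing function $\mathcal{D}\colon\mathbb{R}_+\to\mathbb{R}_+$ with $\mathcal{D}(0)=0$ and $\lim_{t\to\infty}\mathcal{D}(t)=\infty$ such that for every $S>0$ every $S$-component of $X$ is $\mathcal{D}(S)$-bounded. A retraction of $X$ onto $A\subset X$ is a map $r\colon X\to A$ with $r(a)=a$ for all $a\in A$. It is $\mu$-uniform if $d(r(x),r(x'))\le\mu(d(x,x'))$ for all $x,x'\in X$;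 $A$ is then a $\mu$-uniform retract of $X$. A map is metrically proper if preimages of bounded sets are bounded. The Uniform category consists of separable metric spaces and uniform maps (maps $f$ with $d(f(x),f(x'))\le\delta_f(d(x,x'))$ for some function $\delta_f$ with $\delta_f(t)\to0$ as $t\to 0$). The Proper Uniform category is its subcategory of unbounded spaces and metrically proper maps. *)

theory Defs
  imports "HOL-Analysis.Analysis"
begin

text \<open>Metric spaces are carrier sets \<open>X\<close> inside a type of class \<open>metric_space\<close>, with the
  restricted metric.\<close>

text \<open>Self-maps of \<open>[0,\<infinity>)\<close> are represented by total functions on \<open>real\<close>, of which only
  the values on \<open>{0..}\<close> matter.\<close>

definition control_function :: "(real \<Rightarrow> real) \<Rightarrow> bool" where
  "control_function f \<longleftrightarrow>
     f ` {0..} \<subseteq> {0..} \<and> continuous_on {0..} f \<and> strict_mono_on {0..} f \<and>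
     f 0 = 0 \<and> filterlim f at_top at_top"

definition chain_at_scale :: "real \<Rightarrow> 'a::metric_space list \<Rightarrow> bool" where
  "chain_at_scale S xs \<longleftrightarrow> xs \<noteq> [] \<and> successively (\<lambda>x y. dist x y \<le> S) xs"

definition scale_connected :: "real \<Rightarrow> 'a::metric_space set \<Rightarrow> bool" where
  "scale_connected S C \<longleftrightarrow>
     (\<forall>x\<in>C. \<forall>y\<in>C. \<exists>xs. chain_at_scale S xs \<and> set xs \<subseteq> C \<and> hd xs = x \<and> last xs = y)"

definition scale_component :: "real \<Rightarrow> 'a::metric_space set \<Rightarrow> 'a set \<Rightarrow> bool" where
  "scale_component S X C \<longleftrightarrow>
     C \<subseteq> X \<and> scale_connected S C \<and>
     (\<forall>C'. C \<subseteq> C' \<and> C' \<subseteq> X \<and> scale_connected S C' \<longrightarrow> C' = C)"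

definition bounded_by :: "real \<Rightarrow> 'a::metric_space set \<Rightarrow> bool" where
  "bounded_by D C \<longleftrightarrow> (\<forall>x\<in>C. \<forall>y\<in>C. dist x y \<le> D)"

definition dim_u_le_0 :: "'a::metric_space set \<Rightarrow> bool" where
  "dim_u_le_0 X \<longleftrightarrow>
     (\<exists>\<D>. control_function \<D> \<and>
       (\<forall>S>0. \<forall>C. scale_component S X C \<longrightarrow> bounded_by (\<D> S) C))"

text \<open>Unlike the library's \<open>retraction\<close>, no continuity is required here.\<close>

definition retraction_onto :: "'a set \<Rightarrow> 'a set \<Rightarrow> ('a \<Rightarrow> 'a) \<Rightarrow> bool" where
  "retraction_onto X A r \<longleftrightarrow> A \<subseteq> X \<and> r \<in> X \<rightarrow> A \<and> (\<forall>a\<in>A. r a = a)"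

definition uniform_with ::
    "(real \<Rightarrow> real) \<Rightarrow> 'a::metric_space set \<Rightarrow> ('a \<Rightarrow> 'b::metric_space) \<Rightarrow> bool" where
  "uniform_with \<mu> X f \<longleftrightarrow> (\<forall>x\<in>X. \<forall>x'\<in>X. dist (f x) (f x') \<le> \<mu> (dist x x'))"

definition uniform_retract_of ::
    "(real \<Rightarrow> real) \<Rightarrow> 'a::metric_space set \<Rightarrow> 'a set \<Rightarrow> bool" where
  "uniform_retract_of \<mu> A X \<longleftrightarrow> (\<exists>r. retraction_onto X A r \<and> uniform_with \<mu> X r)"

definition metrically_proper ::
    "'a::metric_space set \<Rightarrow> 'b::metric_space set \<Rightarrow> ('a \<Rightarrow> 'b) \<Rightarrow> bool" where
  "metrically_proper X Y f \<longleftrightarrow> (\<forall>B. B \<subseteq> Y \<and> bounded B \<longrightarrow> bounded {x \<in> X. f x \<in> B})"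

end

theory Submission
  imports Defs
begin

text \<open>If \<open>dim\<^sub>u X \<le> 0\<close>, the infimum \<open>\<rho> x y\<close> of the scales at which \<open>x\<close> and \<open>y\<close> are joined by
  a chain is an ultrametric with \<open>\<rho> \<le> d \<le> \<D> \<circ> \<rho>\<close>. In an ultrametric space a map sending \<open>x\<close> to a
  point of \<open>A\<close> within twice the distance \<open>\<delta> x\<close> from \<open>x\<close> to \<open>A\<close>, chosen depending on the ball of
  radius \<open>2 * \<delta> x\<close> around \<open>x\<close> only, is a 2-Lipschitz retraction: either \<open>\<rho> x y\<close> is at least
  \<open>\<delta> x\<close> and \<open>\<delta> y\<close>, or the two balls coincide. Choosing the point almost as far as possible from
  a base point of \<open>A\<close> makes the retraction proper if \<open>A\<close> is unbounded. Hence \<open>\<mu> t = \<D> (2 * t)\<close> works.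

  Conversely, let \<open>x\<close> and \<open>y\<close> be joined by an \<open>S\<close>-chain and retract \<open>X\<close> onto \<open>{x, y}\<close> together
  with the points at distance more than \<open>\<mu> S\<close> from \<open>x\<close>. Along the chain the retraction makes steps
  of length at most \<open>\<mu> S\<close>, so it can leave \<open>x\<close> only for \<open>y\<close>, whence \<open>d x y \<le> \<mu> S\<close>.\<close>

section \<open>Chains as reachability, and the components they form\<close>

definition scale_step :: "real \<Rightarrow> 'a::metric_space set \<Rightarrow> ('a \<times> 'a) set" where
  "scale_step S X = {(x, y). x \<in> X \<and> y \<in> X \<and> dist x y \<le> S}"

lemma sym_scale_step: "sym (scale_step S X)"
  by (auto simp: scale_step_def sym_def dist_commute)

lemma scale_step_mono: "S \<le> T \<Longrightarrow> (scale_step S X)\<^sup>* \<subseteq> (scale_step T X)\<^sup>*"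
  by (intro rtrancl_mono) (auto simp: scale_step_def)

lemma scale_step_rtrancl_in: "(x, y) \<in> (scale_step S X)\<^sup>* \<Longrightarrow> x \<in> X \<Longrightarrow> y \<in> X"
  by (induction rule: rtrancl_induct) (auto simp: scale_step_def)

lemma scale_step_rtrancl_sym:
  "(x, y) \<in> (scale_step S X)\<^sup>* \<Longrightarrow> (y, x) \<in> (scale_step S X)\<^sup>*"
  by (metis sym_scale_step sym_rtrancl symD)

lemma chain_imp_rtrancl:
  assumes "chain_at_scale S xs" "set xs \<subseteq> X"
  shows "(hd xs, last xs) \<in> (scale_step S X)\<^sup>*"
  using assms
proof (induction xs)
  case Nil
  then show ?case by (simp add: chain_at_scale_def)
next
  case (Cons x xs)
  show ?case
  proof (cases xs)
    case Nil
    then show ?thesis by simp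
  next
    case [simp]: (Cons y ys)
    have "(y, last xs) \<in> (scale_step S X)\<^sup>*"
      using Cons.IH Cons.prems by (simp add: chain_at_scale_def)
    moreover have "(x, y) \<in> scale_step S X"
      using Cons.prems by (simp add: chain_at_scale_def scale_step_def)
    ultimately show ?thesis by (simp add: converse_rtrancl_into_rtrancl)
  qed
qed

text \<open>Every prefix of the chain ends in the class of \<open>x\<close>, so the chain stays in
  that class and not merely in \<open>X\<close>; this is what connectedness of a component
  demands.\<close>

lemma rtrancl_imp_chain:
  assumes "(x, y) \<in> (scale_step S X)\<^sup>*"
  shows "\<exists>xs. chain_at_scale S xs \<and> set xs \<subseteq> (scale_step S X)\<^sup>* `` {x} \<and> hd xs = x \<and> last xs = y"
  using assms
proof (induction rule: rtrancl_induct)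
  case base
  show ?case by (rule exI[of _ "[x]"]) (simp add: chain_at_scale_def)
next
  case (step y z)
  then obtain xs where xs: "chain_at_scale S xs" "set xs \<subseteq> (scale_step S X)\<^sup>* `` {x}"
    "hd xs = x" "last xs = y" by blast
  have "z \<in> (scale_step S X)\<^sup>* `` {x}"
    using step.hyps by (auto intro: rtrancl_into_rtrancl)
  with xs step.hyps(2) show ?case
    by (intro exI[of _ "xs @ [z]"])
      (auto simp: chain_at_scale_def successively_append_iff scale_step_def)
qed

text \<open>Reachability is an equivalence relation, so its class is connected, and a connected
  superset inside \<open>X\<close> contains only points reachable from \<open>x\<close>. This
  supplies the components to which the bound from \<open>dim_u_le_0\<close> is applied.\<close>

lemma scale_component_rtrancl:
  assumes "x \<in> X"
  shows "scale_component S X ((scale_step S X)\<^sup>* `` {x})"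
  unfolding scale_component_def
proof (intro conjI allI impI)
  let ?C = "(scale_step S X)\<^sup>* `` {x}"
  show "?C \<subseteq> X" using assms scale_step_rtrancl_in by fast
  show "scale_connected S ?C"
    unfolding scale_connected_def
  proof (intro ballI)
    fix y z assume "y \<in> ?C" "z \<in> ?C"
    then have xy: "(x, y) \<in> (scale_step S X)\<^sup>*" and xz: "(x, z) \<in> (scale_step S X)\<^sup>*" by auto
    have "(y, z) \<in> (scale_step S X)\<^sup>*"
      using scale_step_rtrancl_sym[OF xy] xz by (rule rtrancl_trans)
    then obtain xs where "chain_at_scale S xs" "set xs \<subseteq> (scale_step S X)\<^sup>* `` {y}"
      "hd xs = y" "last xs = z" using rtrancl_imp_chain by blast
    moreover have "(scale_step S X)\<^sup>* `` {y} \<subseteq> ?C" using xy by (auto intro: rtrancl_trans)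
    ultimately show "\<exists>xs. chain_at_scale S xs \<and> set xs \<subseteq> ?C \<and> hd xs = y \<and> last xs = z"
      by blast
  qed
  fix C' assume C': "?C \<subseteq> C' \<and> C' \<subseteq> X \<and> scale_connected S C'"
  have "y \<in> ?C" if y: "y \<in> C'" for y
  proof -
    have "x \<in> C'" using C' by auto
    moreover have "scale_connected S C'" using C' by blast
    ultimately obtain xs where "chain_at_scale S xs" "set xs \<subseteq> C'" "hd xs = x" "last xs = y"
      unfolding scale_connected_def using y by meson
    then have "(x, y) \<in> (scale_step S X)\<^sup>*"
      using chain_imp_rtrancl[of S xs X] C' by auto
    then show ?thesis by simp
  qed
  then show "C' = ?C" using C' by blast
qed

section \<open>The chain ultrametric and its comparison with the metric\<close>

text \<open>The subdominant ultrametric known from single-linkage clustering, in general only a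
  pseudo-ultrametric. The infimum need not be attained, so later estimates work at strictly larger
  scales.\<close>

definition chain_dist :: "'a::metric_space set \<Rightarrow> 'a \<Rightarrow> 'a \<Rightarrow> real" where
  "chain_dist X x y = Inf {S. S > 0 \<and> (x, y) \<in> (scale_step S X)\<^sup>*}"

lemma chain_dist_le:
  assumes "S > 0" "(x, y) \<in> (scale_step S X)\<^sup>*"
  shows "chain_dist X x y \<le> S"
  unfolding chain_dist_def using assms
  by (intro cInf_lower bdd_belowI[of _ 0]) auto

lemma chain_dist_refl: "chain_dist X x x = 0"
proof -
  have "{S::real. S > 0 \<and> (x, x) \<in> (scale_step S X)\<^sup>*} = {0<..}" by auto
  then show ?thesis by (simp add: chain_dist_def)
qed

lemma chain_dist_sym: "chain_dist X x y = chain_dist X y x"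
  unfolding chain_dist_def by (metis scale_step_rtrancl_sym)

lemma chain_dist_le_dist:
  assumes "x \<in> X" "y \<in> X"
  shows "chain_dist X x y \<le> dist x y"
proof (cases "x = y")
  case False
  then show ?thesis using assms
    by (intro chain_dist_le r_into_rtrancl) (auto simp: scale_step_def)
qed (simp add: chain_dist_refl)

lemma scales_nonempty:
  assumes "x \<in> X" "y \<in> X"
  shows "{S. S > 0 \<and> (x, y) \<in> (scale_step S X)\<^sup>*} \<noteq> {}"
proof -
  \<comment> \<open>Adding 1 keeps the scale positive when \<open>x = y\<close>.\<close>
  have "(x, y) \<in> (scale_step (dist x y + 1) X)\<^sup>*"
    using assms by (intro r_into_rtrancl) (simp add: scale_step_def)
  moreover have "dist x y + 1 > 0" by (simp add: add_nonneg_pos)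
  ultimately show ?thesis by blast
qed

lemma chain_dist_nonneg:
  assumes "x \<in> X" "y \<in> X"
  shows "chain_dist X x y \<ge> 0"
  unfolding chain_dist_def using scales_nonempty[OF assms] by (rule cInf_greatest) auto

lemma chain_dist_less_imp_rtrancl:
  assumes "x \<in> X" "y \<in> X" "chain_dist X x y < S"
  shows "(x, y) \<in> (scale_step S X)\<^sup>*"
proof -
  obtain T where "(x, y) \<in> (scale_step T X)\<^sup>*" "T < S"
    using cInf_lessD[OF scales_nonempty[OF assms(1,2)]] assms(3) unfolding chain_dist_def by blast
  then show ?thesis using scale_step_mono[of T S X] by auto
qed

text \<open>At any scale above both distances the two chains exist and can be concatenated; the
  bound then follows by density of the reals.\<close>

lemma chain_dist_ultra:
  assumes "x \<in> X" "y \<in> X" "z \<in> X"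
  shows "chain_dist X x z \<le> max (chain_dist X x y) (chain_dist X y z)"
proof (rule dense_ge)
  fix S assume S: "max (chain_dist X x y) (chain_dist X y z) < S"
  then have "S > 0" using chain_dist_nonneg[OF assms(1,2)] by simp
  moreover have "(x, z) \<in> (scale_step S X)\<^sup>*"
    using chain_dist_less_imp_rtrancl[of x X y S] chain_dist_less_imp_rtrancl[of y X z S] assms S
    by (auto intro: rtrancl_trans)
  ultimately show "chain_dist X x z \<le> S" by (rule chain_dist_le)
qed

lemma control_function_mono:
  assumes "control_function f" "0 \<le> s" "s \<le> t"
  shows "f s \<le> f t"
  using assms unfolding control_function_def
  by (meson strict_mono_on_imp_mono_on mono_onD atLeast_iff order_trans)

text \<open>At each scale \<open>s\<close> above the chain distance both points lie in one
  component, so \<open>dist x y \<le> D s\<close>. Continuity of \<open>D\<close> lets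
  \<open>s\<close> decrease to the chain distance.\<close>

lemma dist_le_control_chain_dist:
  assumes D: "control_function D"
    and comp: "\<And>S C. S > 0 \<Longrightarrow> scale_component S X C \<Longrightarrow> bounded_by (D S) C"
    and xy: "x \<in> X" "y \<in> X"
  shows "dist x y \<le> D (chain_dist X x y)"
proof -
  let ?t = "chain_dist X x y"
  have t: "?t \<ge> 0" using chain_dist_nonneg[OF xy] .
  have le: "dist x y \<le> D s" if "?t < s" for s
  proof -
    have "bounded_by (D s) ((scale_step s X)\<^sup>* `` {x})"
      using comp[OF _ scale_component_rtrancl[OF xy(1)], of s] t that by linarith
    moreover have "(x, y) \<in> (scale_step s X)\<^sup>*"
      using chain_dist_less_imp_rtrancl[OF xy that] .
    ultimately show ?thesis by (auto simp: bounded_by_def)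
  qed
  have "(D \<longlongrightarrow> D ?t) (at ?t within {0..})"
    using D t by (auto simp: control_function_def continuous_on)
  then have "(D \<longlongrightarrow> D ?t) (at_right ?t)"
    by (rule tendsto_within_subset) (use t in auto)
  then show ?thesis
    by (rule tendsto_lowerbound)
      (auto intro: eventually_mono[OF eventually_at_right_less] le)
qed

section \<open>Lipschitz retractions in ultrametric spaces\<close>

text \<open>A supremum need not be attained, but a positive one is exceeded when halved; if it is
  not positive, \<open>f\<close> vanishes on \<open>K\<close> and any point serves.\<close>

lemma ex_half_maximal:
  fixes f :: "'a \<Rightarrow> real"
  assumes "K \<noteq> {}" "bdd_above (f ` K)" "\<And>a. a \<in> K \<Longrightarrow> f a \<ge> 0"
  shows "\<exists>a\<in>K. \<forall>b\<in>K. f b \<le> 2 * f a"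
proof (cases "Sup (f ` K) > 0")
  case True
  then have "Sup (f ` K) / 2 < Sup (f ` K)" by simp
  then obtain a where a: "a \<in> K" "Sup (f ` K) / 2 < f a"
    unfolding less_cSUP_iff[OF assms(1,2)] by blast
  have "f b \<le> 2 * f a" if "b \<in> K" for b
    using cSUP_upper[OF that assms(2)] a(2) by linarith
  with a(1) show ?thesis by blast
next
  case False
  obtain a where "a \<in> K" using assms by blast
  moreover have "f b \<le> 2 * f a" if "b \<in> K" for b
    using cSUP_upper[OF that assms(2)] False assms(3)[OF \<open>a \<in> K\<close>] by linarith
  ultimately show ?thesis by blast
qed

text \<open>The last conclusion prepares properness: once some \<open>a\<close> in \<open>A\<close>
  is far from \<open>p\<close>, points whose images are near \<open>p\<close> are confined to a ball
  around \<open>p\<close>.\<close>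

lemma ultrametric_retraction:
  fixes \<rho> :: "'a \<Rightarrow> 'a \<Rightarrow> real"
  assumes nonneg: "\<And>x y. x \<in> X \<Longrightarrow> y \<in> X \<Longrightarrow> \<rho> x y \<ge> 0"
    and zero: "\<And>x y. x \<in> X \<Longrightarrow> y \<in> X \<Longrightarrow> \<rho> x y = 0 \<longleftrightarrow> x = y"
    and sym: "\<And>x y. \<rho> x y = \<rho> y x"
    and ultra: "\<And>x y z. x \<in> X \<Longrightarrow> y \<in> X \<Longrightarrow> z \<in> X \<Longrightarrow> \<rho> x z \<le> max (\<rho> x y) (\<rho> y z)"
    and A: "A \<subseteq> X" "p \<in> A"
    and closed: "\<And>x. x \<in> X \<Longrightarrow> \<forall>e>0. \<exists>a\<in>A. \<rho> x a < e \<Longrightarrow> x \<in> A"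
  shows "\<exists>r. retraction_onto X A r \<and>
    (\<forall>x\<in>X. \<forall>y\<in>X. \<rho> (r x) (r y) \<le> 2 * \<rho> x y) \<and>
    (\<forall>x\<in>X. \<forall>a\<in>A. 2 * \<rho> (r x) p < \<rho> a p \<longrightarrow> \<rho> x p \<le> \<rho> a p)"
proof -
  define \<delta> where "\<delta> x = Inf (\<rho> x ` A)" for x
  define K where "K x = {a \<in> A. \<rho> x a \<le> 2 * \<delta> x}" for x
  \<comment> \<open>The choice depends on \<open>x\<close> only through \<open>K x\<close>, so equal
    candidate sets give equal values.\<close>
  define r where "r x = (SOME a. a \<in> K x \<and> (\<forall>b\<in>K x. \<rho> b p \<le> 2 * \<rho> a p))" for x
  have pX: "p \<in> X" using A by blast
  have ne: "\<rho> x ` A \<noteq> {}" for x using A by blast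
  have \<delta>_le: "\<delta> x \<le> \<rho> x a" if "x \<in> X" "a \<in> A" for x a
    unfolding \<delta>_def using that A nonneg by (intro cInf_lower bdd_belowI[of _ 0]) auto
  have \<delta>_nonneg: "\<delta> x \<ge> 0" if "x \<in> X" for x
    unfolding \<delta>_def using ne by (rule cInf_greatest) (use that A nonneg in auto)
  have \<delta>_less: "\<exists>a\<in>A. \<rho> x a < s" if "\<delta> x < s" for x s
    using cInf_lessD[OF ne, of x s] that unfolding \<delta>_def by blast
  \<comment> \<open>The factor 2 leaves room above a positive infimum; if the infimum is 0,
    closedness puts \<open>x\<close> itself into \<open>A\<close>.\<close>
  have K_ne: "K x \<noteq> {}" if x: "x \<in> X" for x
  proof (cases "\<delta> x = 0")
    case True
    have "x \<in> A" using closed[OF x] \<delta>_less[of x] True by simp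
    then have "x \<in> K x" using True zero[OF x x] by (simp add: K_def)
    then show ?thesis by blast
  next
    case False
    then have "\<delta> x < 2 * \<delta> x" using \<delta>_nonneg[OF x] by simp
    then show ?thesis using \<delta>_less unfolding K_def by fastforce
  qed
  have r: "r x \<in> K x \<and> (\<forall>b\<in>K x. \<rho> b p \<le> 2 * \<rho> (r x) p)" if x: "x \<in> X" for x
  proof -
    have "\<rho> b p \<le> max (2 * \<delta> x) (\<rho> x p)" if "b \<in> K x" for b
      using that ultra[of b x p] sym[of b x] A x pX by (auto simp: K_def)
    then have "bdd_above ((\<lambda>b. \<rho> b p) ` K x)" by (intro bdd_aboveI2)
    then have "\<exists>a\<in>K x. \<forall>b\<in>K x. \<rho> b p \<le> 2 * \<rho> a p"
      using K_ne[OF x] nonneg A pX by (intro ex_half_maximal) (auto simp: K_def)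
    then have "\<exists>a. a \<in> K x \<and> (\<forall>b\<in>K x. \<rho> b p \<le> 2 * \<rho> a p)" by blast
    then show ?thesis unfolding r_def by (rule someI_ex)
  qed
  then have rA: "r x \<in> A" and r_le: "\<rho> x (r x) \<le> 2 * \<delta> x" if "x \<in> X" for x
    using that by (auto simp: K_def)
  \<comment> \<open>Otherwise a point of \<open>A\<close> closer than \<open>\<delta> y\<close> to
    \<open>x\<close> would, by the ultrametric inequality, also be closer than
    \<open>\<delta> y\<close> to \<open>y\<close>.\<close>
  have \<delta>_const: "\<delta> y \<le> \<delta> x" if "x \<in> X" "y \<in> X" "\<rho> x y < \<delta> y" for x y
  proof (rule ccontr)
    assume "\<not> \<delta> y \<le> \<delta> x"
    then obtain a where "a \<in> A" "\<rho> x a < \<delta> y" using \<delta>_less by (meson not_le)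
    then show False using ultra[of y x a] \<delta>_le[of y a] sym[of y x] that A by auto
  qed
  have K_sub: "K x \<subseteq> K y" if "x \<in> X" "y \<in> X" "\<rho> x y < \<delta> x" "\<delta> x = \<delta> y" for x y
    using that ultra[of y x] sym[of y x] A \<delta>_nonneg[of x] unfolding K_def by fastforce
  have r_eq: "r x = r y" if "x \<in> X" "y \<in> X" "\<rho> x y < \<delta> x" for x y
  proof -
    \<comment> \<open>This direction comes first: it turns \<open>\<rho> x y < \<delta> x\<close>
      into \<open>\<rho> x y < \<delta> y\<close>, which the reverse inequality requires.\<close>
    have "\<delta> x \<le> \<delta> y" using \<delta>_const[of y x] that sym[of x y] by simp
    moreover from this have "\<delta> y \<le> \<delta> x" using \<delta>_const[of x y] that by simp
    ultimately have eq: "\<delta> x = \<delta> y" by simp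
    have "K x \<subseteq> K y" using that eq by (rule K_sub)
    moreover have "K y \<subseteq> K x" using that eq sym[of x y] by (intro K_sub) simp_all
    ultimately have "K x = K y" by (rule subset_antisym)
    then show ?thesis by (simp add: r_def)
  qed
  show ?thesis
  proof (intro exI conjI ballI impI)
    have "r a = a" if "a \<in> A" for a
    proof -
      have a: "a \<in> X" using that A by blast
      have "\<delta> a \<le> 0" using \<delta>_le[OF a that] zero[OF a a] by simp
      then have "\<rho> a (r a) = 0" using r_le[OF a] nonneg[OF a, of "r a"] rA[OF a] A by auto
      then show ?thesis using zero[OF a, of "r a"] rA[OF a] A by auto
    qed
    then show "retraction_onto X A r" using A rA by (auto simp: retraction_onto_def)
  next
    fix x y assume x: "x \<in> X" and y: "y \<in> X"
    show "\<rho> (r x) (r y) \<le> 2 * \<rho> x y"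
    proof (cases "\<rho> x y < \<delta> x \<or> \<rho> x y < \<delta> y")
      case True
      then have "r x = r y" using r_eq[of x y] r_eq[of y x] x y sym[of x y] by auto
      moreover have "r y \<in> X" using rA[OF y] A by blast
      ultimately show ?thesis using zero[of "r y" "r y"] nonneg[OF x y] by simp
    next
      case False
      have X: "r x \<in> X" "r y \<in> X" using rA x y A by auto
      have "\<rho> (r x) (r y) \<le> max (\<rho> x (r x)) (max (\<rho> x y) (\<rho> y (r y)))"
        using ultra[OF X(1) x X(2)] ultra[OF x y X(2)] sym[of x "r x"] by auto
      then show ?thesis using r_le[OF x] r_le[OF y] False nonneg[OF x y] by linarith
    qed
  next
    fix x a assume x: "x \<in> X" and a: "a \<in> A" and less: "2 * \<rho> (r x) p < \<rho> a p"
    have rX: "r x \<in> X" using rA[OF x] A by blast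
    show "\<rho> x p \<le> \<rho> a p"
    proof (cases "\<rho> x p \<le> 2 * \<delta> x")
      case True
      \<comment> \<open>Half-maximality of \<open>r x\<close> excludes \<open>a\<close> from the
        candidates. So \<open>x\<close> is farther from \<open>a\<close> than from \<open>p\<close>,
        and the ultrametric inequality gives \<open>\<rho> x a \<le> \<rho> p a\<close>.\<close>
      have "a \<notin> K x" using r[OF x] less by force
      then have "2 * \<delta> x < \<rho> x a" using a by (auto simp: K_def)
      then show ?thesis
        using True ultra[of x p a] x pX a A sym[of p a] by auto
    next
      case False
      \<comment> \<open>Here \<open>p\<close> is farther from \<open>x\<close> than
        \<open>r x\<close> is, so \<open>\<rho> x p \<le> \<rho> (r x) p\<close>.\<close>
      then show ?thesis
        using ultra[OF x rX pX] r_le[OF x] less nonneg[OF rX pX] by linarith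
    qed
  qed
qed

section \<open>From dimension zero to uniform and proper retractions\<close>

lemma dim_u_le_0_imp_retraction:
  fixes X :: "'a::metric_space set"
  assumes "dim_u_le_0 X"
  obtains \<mu> where "control_function \<mu>"
    and "\<And>A. A \<noteq> {} \<Longrightarrow> closedin (top_of_set X) A \<Longrightarrow>
      \<exists>r. retraction_onto X A r \<and> uniform_with \<mu> X r \<and> (\<not> bounded A \<longrightarrow> metrically_proper X A r)"
proof -
  obtain D where D: "control_function D"
    and comp: "\<And>S C. S > 0 \<Longrightarrow> scale_component S X C \<Longrightarrow> bounded_by (D S) C"
    using assms by (auto simp: dim_u_le_0_def)
  let ?\<rho> = "chain_dist X"
  have dist_le: "dist x y \<le> D (?\<rho> x y)" if "x \<in> X" "y \<in> X" for x y
    using D comp that by (rule dist_le_control_chain_dist)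
  have D0: "D 0 = 0" using D by (simp add: control_function_def)
  \<comment> \<open>Since \<open>D 0 = 0\<close>, the bound on \<open>dist\<close> makes the
    pseudo-ultrametric separate points.\<close>
  have zero: "?\<rho> x y = 0 \<longleftrightarrow> x = y" if "x \<in> X" "y \<in> X" for x y
    using dist_le[OF that] D0 by (auto simp: chain_dist_refl)
  show thesis
  proof
    show "control_function (\<lambda>t. D (2 * t))"
      unfolding control_function_def
    proof (intro conjI)
      show "(\<lambda>t. D (2 * t)) ` {0..} \<subseteq> {0..}"
        using D by (auto simp: control_function_def image_subset_iff)
      show "continuous_on {0..} (\<lambda>t. D (2 * t))"
        by (rule continuous_on_compose2[of "{0..}" D])
          (use D in \<open>auto simp: control_function_def intro!: continuous_intros\<close>)
      show "strict_mono_on {0..} (\<lambda>t. D (2 * t))"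
        using D by (auto simp: control_function_def strict_mono_on_def)
      show "D (2 * 0) = 0" using D0 by simp
      have "filterlim (\<lambda>t::real. 2 * t) at_top at_top"
        by (rule filterlim_tendsto_pos_mult_at_top[OF tendsto_const]) (auto simp: filterlim_ident)
      then show "filterlim (\<lambda>t. D (2 * t)) at_top at_top"
        by (rule filterlim_compose[rotated]) (use D in \<open>simp add: control_function_def\<close>)
    qed
  next
    fix A assume "A \<noteq> {}" and cl: "closedin (top_of_set X) A"
    then obtain p where p: "p \<in> A" by blast
    have AX: "A \<subseteq> X" using cl by (simp add: closedin_subset_trans closedin_imp_subset)
    have pX: "p \<in> X" using p AX by blast
    \<comment> \<open>Continuity of \<open>D\<close> at 0 makes points close in the chain
      ultrametric close in the metric, so metric closedness suffices.\<close>
    have closed: "x \<in> A" if x: "x \<in> X" and e: "\<forall>e>0. \<exists>a\<in>A. ?\<rho> x a < e" for x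
    proof -
      have "x \<in> closure A"
        unfolding closure_approachable
      proof (intro allI impI)
        fix e :: real assume "e > 0"
        have "continuous_on {0..} D" using D by (simp add: control_function_def)
        then have "\<exists>d>0. \<forall>t\<in>{0..}. dist t 0 < d \<longrightarrow> dist (D t) (D 0) < e"
          using \<open>e > 0\<close> unfolding continuous_on_iff by (meson atLeast_iff order_refl)
        then obtain d where d: "d > 0" "\<And>t. t \<ge> 0 \<Longrightarrow> t < d \<Longrightarrow> D t < e"
          using D0 by (fastforce simp: dist_real_def)
        obtain a where a: "a \<in> A" "?\<rho> x a < d" using e \<open>d > 0\<close> by blast
        then have "a \<in> X" using AX by blast
        then have "dist x a < e"
          using dist_le[OF x] d(2)[OF chain_dist_nonneg[OF x] a(2)] by fastforce
        then show "\<exists>a\<in>A. dist a x < e" using a(1) by (metis dist_commute)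
      qed
      then show ?thesis using cl x by (auto simp: closedin_limpt closure_def)
    qed
    have "\<exists>r. retraction_onto X A r \<and>
        (\<forall>x\<in>X. \<forall>y\<in>X. ?\<rho> (r x) (r y) \<le> 2 * ?\<rho> x y) \<and>
        (\<forall>x\<in>X. \<forall>a\<in>A. 2 * ?\<rho> (r x) p < ?\<rho> a p \<longrightarrow> ?\<rho> x p \<le> ?\<rho> a p)"
      using chain_dist_nonneg zero chain_dist_sym chain_dist_ultra AX p closed
      by (rule ultrametric_retraction)
    then obtain r where r: "retraction_onto X A r"
      and lip: "\<And>x y. x \<in> X \<Longrightarrow> y \<in> X \<Longrightarrow> ?\<rho> (r x) (r y) \<le> 2 * ?\<rho> x y"
      and far: "\<And>x a. x \<in> X \<Longrightarrow> a \<in> A \<Longrightarrow> 2 * ?\<rho> (r x) p < ?\<rho> a p \<Longrightarrow> ?\<rho> x p \<le> ?\<rho> a p"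
      by blast
    have rA: "r x \<in> A" if "x \<in> X" for x using r that by (auto simp: retraction_onto_def)
    then have rX: "r x \<in> X" if "x \<in> X" for x using that AX by blast
    have "uniform_with (\<lambda>t. D (2 * t)) X r"
      unfolding uniform_with_def
    proof (intro ballI)
      fix x y assume x: "x \<in> X" and y: "y \<in> X"
      have "?\<rho> (r x) (r y) \<le> 2 * dist x y"
        using lip[OF x y] chain_dist_le_dist[OF x y] by linarith
      then have "D (?\<rho> (r x) (r y)) \<le> D (2 * dist x y)"
        using chain_dist_nonneg[OF rX[OF x] rX[OF y]] by (intro control_function_mono[OF D])
      then show "dist (r x) (r y) \<le> D (2 * dist x y)"
        using dist_le[OF rX[OF x] rX[OF y]] by linarith
    qed
    moreover have "metrically_proper X A r" if unb: "\<not> bounded A"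
      unfolding metrically_proper_def
    proof (intro allI impI)
      fix B assume "B \<subseteq> A \<and> bounded B"
      then obtain R where R: "\<And>b. b \<in> B \<Longrightarrow> dist p b \<le> R" and BA: "B \<subseteq> A"
        using bounded_any_center[of B p] by auto
      \<comment> \<open>If \<open>r x\<close> lies in \<open>B\<close>, then twice its chain
        distance to \<open>p\<close> is at most \<open>2 * R\<close>, so such an \<open>a\<close>
        makes \<open>far\<close> applicable. Without one, \<open>A\<close> would lie within
        \<open>D (2 * R)\<close> of \<open>p\<close>.\<close>
      have "\<exists>a\<in>A. 2 * R < ?\<rho> a p"
      proof (rule ccontr)
        assume "\<not> (\<exists>a\<in>A. 2 * R < ?\<rho> a p)"
        then have le: "?\<rho> a p \<le> 2 * R" if "a \<in> A" for a using that by force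
        have "dist a p \<le> D (2 * R)" if "a \<in> A" for a
        proof -
          have a: "a \<in> X" using that AX by blast
          show ?thesis
            using dist_le[OF a pX]
              control_function_mono[OF D chain_dist_nonneg[OF a pX] le[OF that]] by linarith
        qed
        then have "bounded A" unfolding bounded_any_center[of A p] by (auto simp: dist_commute)
        then show False using unb by blast
      qed
      then obtain a where a: "a \<in> A" "2 * R < ?\<rho> a p" by blast
      have "dist p x \<le> D (?\<rho> a p)" if x: "x \<in> X" and "r x \<in> B" for x
      proof -
        have "?\<rho> (r x) p \<le> R"
          using R[OF \<open>r x \<in> B\<close>] chain_dist_le_dist[OF rX[OF x] pX] by (simp add: dist_commute)
        then have "?\<rho> x p \<le> ?\<rho> a p" using far[OF x a(1)] a(2) by linarith
        then have "D (?\<rho> x p) \<le> D (?\<rho> a p)"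
          by (intro control_function_mono[OF D chain_dist_nonneg[OF x pX]])
        then show ?thesis using dist_le[OF x pX] by (simp add: dist_commute)
      qed
      then show "bounded {x \<in> X. r x \<in> B}" unfolding bounded_any_center[of _ p] by blast
    qed
    ultimately show "\<exists>r. retraction_onto X A r \<and> uniform_with (\<lambda>t. D (2 * t)) X r \<and>
        (\<not> bounded A \<longrightarrow> metrically_proper X A r)" using r by blast
  qed
qed

section \<open>From retractions back to dimension zero\<close>

lemma closedin_pair_Un_far:
  assumes "x \<in> X" "y \<in> X"
  shows "closedin (top_of_set X) ({x, y} \<union> {z \<in> X. dist x z \<ge> R})"
proof -
  have "closed ({x, y} \<union> {z. dist x z \<ge> R})"
    by (intro closed_Un closed_Collect_le continuous_intros finite_imp_closed) simp
  then have "closedin (top_of_set X) (X \<inter> ({x, y} \<union> {z. dist x z \<ge> R}))"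
    by (rule closedin_closed_Int)
  moreover have "X \<inter> ({x, y} \<union> {z. dist x z \<ge> R}) = {x, y} \<union> {z \<in> X. dist x z \<ge> R}"
    using assms by auto
  ultimately show ?thesis by simp
qed

text \<open>Together with a ball the set covers \<open>X\<close>. Hence the same test sets serve in
  the Proper Uniform category.\<close>

lemma unbounded_pair_Un_far:
  assumes "\<not> bounded X"
  shows "\<not> bounded ({x, y} \<union> {z \<in> X. dist x z \<ge> R})"
proof
  assume "bounded ({x, y} \<union> {z \<in> X. dist x z \<ge> R})"
  then have "bounded (({x, y} \<union> {z \<in> X. dist x z \<ge> R}) \<union> cball x R)"
    by (simp only: bounded_Un bounded_cball)
  moreover have "X \<subseteq> ({x, y} \<union> {z \<in> X. dist x z \<ge> R}) \<union> cball x R" by auto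
  ultimately show False using assms bounded_subset by blast
qed

text \<open>Retractions are asked for only onto the test sets, so that condition (2) of either
  category supplies them; \<open>\<mu>\<close> itself bounds the components.\<close>

lemma retraction_imp_dim_u_le_0:
  assumes \<mu>: "control_function \<mu>"
    and retr: "\<And>x y R. x \<in> X \<Longrightarrow> y \<in> X \<Longrightarrow>
      \<exists>r. retraction_onto X ({x, y} \<union> {z \<in> X. dist x z \<ge> R}) r \<and> uniform_with \<mu> X r"
  shows "dim_u_le_0 X"
  unfolding dim_u_le_0_def
proof (intro exI conjI allI impI)
  show "control_function \<mu>" by fact
  fix S :: real and C assume S: "S > 0" and C: "scale_component S X C"
  show "bounded_by (\<mu> S) C"
    unfolding bounded_by_def
  proof (intro ballI)
    fix x y assume xy: "x \<in> C" "y \<in> C"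
    have CX: "C \<subseteq> X" using C by (simp add: scale_component_def)
    \<comment> \<open>The offset 1 lets a closed condition place the far points strictly beyond
      \<open>\<mu> S\<close>.\<close>
    let ?A = "{x, y} \<union> {z \<in> X. dist x z \<ge> \<mu> S + 1}"
    obtain r where r: "retraction_onto X ?A r" and u: "uniform_with \<mu> X r"
      using retr[of x y "\<mu> S + 1"] xy CX by blast
    have r_xy: "r x = x" "r y = y" using r by (auto simp: retraction_onto_def)
    obtain xs where "chain_at_scale S xs" "set xs \<subseteq> C" "hd xs = x" "last xs = y"
      using C xy unfolding scale_component_def scale_connected_def by blast
    then have "(x, y) \<in> (scale_step S X)\<^sup>*"
      using chain_imp_rtrancl[of S xs X] CX by auto
    \<comment> \<open>The second alternative is the desired bound, so it persists once reached. A
      step leaving \<open>x\<close> has length at most \<open>\<mu> S\<close>, hence misses the far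
      points and must land on \<open>y\<close>.\<close>
    moreover have "r z = x \<or> dist x y \<le> \<mu> S" if "(x, z) \<in> (scale_step S X)\<^sup>*" for z
      using that
    proof (induction rule: rtrancl_induct)
      case base
      then show ?case using r_xy by simp
    next
      case (step v w)
      then have vw: "v \<in> X" "w \<in> X" "dist v w \<le> S" by (auto simp: scale_step_def)
      have le: "dist (r v) (r w) \<le> \<mu> S"
        using u vw control_function_mono[OF \<mu> zero_le_dist vw(3)]
        by (fastforce simp: uniform_with_def)
      have "r w \<in> ?A" using r vw by (auto simp: retraction_onto_def)
      then show ?case using step.IH le by auto
    qed
    \<comment> \<open>At \<open>z = y\<close> the first alternative means \<open>x = y\<close>,
      where nonnegativity gives the bound.\<close>
    moreover have "\<mu> S \<ge> 0" using \<mu> S by (auto simp: control_function_def image_subset_iff)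
    ultimately show "dist x y \<le> \<mu> S" using r_xy by force
  qed
qed

section \<open>Assembling the equivalences in the two categories\<close>

theorem theorem4p5:
  fixes X :: "'a::metric_space set"
  assumes "separable_space (top_of_set X)"
  shows "(X \<noteq> {} \<longrightarrow>
           (dim_u_le_0 X \<longleftrightarrow>
             (\<exists>\<mu>. control_function \<mu> \<and>
               (\<forall>A. A \<noteq> {} \<and> closedin (top_of_set X) A \<longrightarrow> uniform_retract_of \<mu> A X)))) \<and>
         (\<not> bounded X \<longrightarrow>
           (dim_u_le_0 X \<longleftrightarrow>
             (\<exists>\<mu>. control_function \<mu> \<and>
               (\<forall>A. \<not> bounded A \<and> closedin (top_of_set X) A \<longrightarrow>
                 (\<exists>r. retraction_onto X A r \<and> uniform_with \<mu> X r \<and> metrically_proper X A r)))))"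
proof (intro conjI impI iffI)
  assume "dim_u_le_0 X"
  then obtain \<mu> where \<mu>: "control_function \<mu>" and retr: "\<And>A. A \<noteq> {} \<Longrightarrow> closedin (top_of_set X) A \<Longrightarrow>
      \<exists>r. retraction_onto X A r \<and> uniform_with \<mu> X r \<and> (\<not> bounded A \<longrightarrow> metrically_proper X A r)"
    using dim_u_le_0_imp_retraction by blast
  show "\<exists>\<mu>. control_function \<mu> \<and>
      (\<forall>A. A \<noteq> {} \<and> closedin (top_of_set X) A \<longrightarrow> uniform_retract_of \<mu> A X)"
    using \<mu> retr unfolding uniform_retract_of_def by blast
  \<comment> \<open>An unbounded \<open>A\<close> is nonempty, so \<open>retr\<close> applies to it
    and also yields properness.\<close>
  show "\<exists>\<mu>. control_function \<mu> \<and>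
      (\<forall>A. \<not> bounded A \<and> closedin (top_of_set X) A \<longrightarrow>
        (\<exists>r. retraction_onto X A r \<and> uniform_with \<mu> X r \<and> metrically_proper X A r))"
    using \<mu> retr by (metis bounded_empty)
next
  assume "\<exists>\<mu>. control_function \<mu> \<and>
      (\<forall>A. A \<noteq> {} \<and> closedin (top_of_set X) A \<longrightarrow> uniform_retract_of \<mu> A X)"
  then obtain \<mu> where \<mu>: "control_function \<mu>"
    and retr: "\<And>A. A \<noteq> {} \<Longrightarrow> closedin (top_of_set X) A \<Longrightarrow> uniform_retract_of \<mu> A X" by blast
  show "dim_u_le_0 X"
    by (rule retraction_imp_dim_u_le_0[OF \<mu> retr[unfolded uniform_retract_of_def]])
      (simp_all only: closedin_pair_Un_far Un_empty insert_not_empty simp_thms)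
next
  assume unb: "\<not> bounded X"
  assume "\<exists>\<mu>. control_function \<mu> \<and>
      (\<forall>A. \<not> bounded A \<and> closedin (top_of_set X) A \<longrightarrow>
        (\<exists>r. retraction_onto X A r \<and> uniform_with \<mu> X r \<and> metrically_proper X A r))"
  then obtain \<mu> where \<mu>: "control_function \<mu>"
    and retr: "\<And>A. \<not> bounded A \<Longrightarrow> closedin (top_of_set X) A \<Longrightarrow>
      \<exists>r. retraction_onto X A r \<and> uniform_with \<mu> X r" by blast
  show "dim_u_le_0 X"
    by (rule retraction_imp_dim_u_le_0[OF \<mu> retr])
      (use unb in \<open>simp_all only: unbounded_pair_Un_far closedin_pair_Un_far not_False_eq_True\<close>)
qed

end
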